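(* Let $\mathcal{K}$ be a finite chain complex of cells over $\mathbb{Z}_2$ with a filtering function $g:\mathcal{K}\to\mathbb{Z}$. Let $(A,b)\in\mathcal{K}\times\mathcal{K}$ be a coreduction pair in $\mathcal{K}$ (that is, $b$ is the unique cell in the boundary of $A$), and suppose that $g(A)=g(b)$. Then $\mathcal{K}$ and $\mathcal{K}\setminus\{A,b\}$ (with $g$ restricted to it) have the same persistent homology in every dimension.
   Context: Chain complexes. A (finite) chain complex of cells $\mathcal{K}$ over $\mathbb{Z}_2$ is a finite set of abstract cells, each with a dimension $p\ge 0$. Let $C_p(\mathcal{K})$ be the $\mathbb{Z}_2$-vector space with basis the $p$-cells of $\mathcal{K}$. There are linear boundary operators $\partial_p:C_p(\mathcal{K})\to C_{p-1}(\mathcal{K})$ (with $\partial_0=0$) satisfying $\partial_p\circ\partial_{p+1}=0$. Homology is $H_p(\mathcal{K})=\ker\partial_p/\operatorname{im}\partial_{p+1}$. A $(p-1)$-cell $a$ is a face of a $p$-cell $B$ if $a$ appears with nonzero coefficient in $\partial B$. The complex need not come from a simplicial or cubical complex. Coreduction pairs. A pair of cells $(A,b)$ is a coreduction pair in $\mathcal{K}$ if $b$ is the unique element in the boundary of $A$, i.e. $\partial A=b$. Filtrations. A filtering function is a map $g:\mathcal{K}\to\mathbb{Z}$ with $g(a)\le g(B)$ whenever $a$ is a face of $B$. Then each $\mathcal{K}_t=\{c\in\mathcal{K}:g(c)\le t\}$ is a chain complex of cells (the boundary of each of its cells lies in it), with boundary operator restricted from $\mathcal{K}$. Removal of cells.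 $\mathcal{K}\setminus\{A,b\}$ is the set of cells obtained by deleting $A$ and $b$, with boundary operator obtained from that of $\mathcal{K}$ by deleting all terms involving the removed cells (the result is again a chain complex of cells). It is filtered by the restriction of $g$. Persistence. For a filtered complex $X$ and integers $i\le j$, the $p$-th persistent homology groups are the images $\operatorname{im}\big(H_p(X_i)\to H_p(X_j)\big)$ of the maps induced by inclusion $X_i\hookrightarrow X_j$. The persistence of $X$ in dimension $p$ is represented by the multiset of persistence intervals (birth, death), i.e. the intervals of the decomposition of the sequence of vector spaces $\cdots\to H_p(X_i)\to H_p(X_{i+1})\to\cdots$ into interval modules; zero-length intervals are disregarded. Two filtered complexes have the same persistent homology in dimension $p$ if these multisets of intervals coincide. *)

theory Defs
  imports
    "HOL-Algebra.Coset"
    "HOL-Algebra.Product_Groups"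
    "HOL-Library.Poly_Mapping"
    "HOL-Library.Multiset"
    "HOL-Library.Extended"
    "HOL-Library.Z2"
begin

text \<open>
  Scalars are always in the field with two elements (type \<^typ>\<open>bit\<close>). Over this field an additive
  map is the same thing as a linear map, and a subgroup the same thing as a subspace; hence
  vector spaces, linear maps, quotients and isomorphisms are rendered by the groups, \<^const>\<open>hom\<close>,
  \<^const>\<open>FactGroup\<close> and \<^const>\<open>iso\<close> of HOL-Algebra (all groups below are written with addition
  as the group operation).
\<close>

section \<open>Chain complexes of cells\<close>

type_synonym 'a chain = "'a \<Rightarrow>\<^sub>0 bit"

record 'a cell_complex =
  cells :: "'a set"
  cell_dim :: "'a \<Rightarrow> nat"
  bd :: "nat \<Rightarrow> 'a chain \<Rightarrow> 'a chain"

definition chain_group :: "'a cell_complex \<Rightarrow> nat \<Rightarrow> 'a chain monoid" where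
  "chain_group X p =
     \<lparr>carrier = {c. Poly_Mapping.keys c \<subseteq> {a \<in> cells X. cell_dim X a = p}},
      monoid.mult = (+), one = 0\<rparr>"

abbreviation cell_chain :: "'a \<Rightarrow> 'a chain" where
  "cell_chain a \<equiv> Poly_Mapping.single a 1"

text \<open>Only the values of \<open>bd X p\<close> on \<open>p\<close>-chains of \<open>X\<close> matter. As there are no chains in
  dimension \<open>-1\<close>, \<open>bd X 0\<close> is the zero map.\<close>

definition chain_complex :: "'a cell_complex \<Rightarrow> bool" where
  "chain_complex X \<longleftrightarrow>
     finite (cells X) \<and>
     (\<forall>p. bd X (Suc p) \<in> hom (chain_group X (Suc p)) (chain_group X p)) \<and>
     (\<forall>c \<in> carrier (chain_group X 0). bd X 0 c = 0) \<and>
     (\<forall>p. \<forall>c \<in> carrier (chain_group X (Suc p)). bd X p (bd X (Suc p) c) = 0)"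

definition cell_boundary :: "'a cell_complex \<Rightarrow> 'a \<Rightarrow> 'a chain" where
  "cell_boundary X A = bd X (cell_dim X A) (cell_chain A)"

definition is_face :: "'a cell_complex \<Rightarrow> 'a \<Rightarrow> 'a \<Rightarrow> bool" where
  "is_face X a B \<longleftrightarrow>
     a \<in> cells X \<and> B \<in> cells X \<and> Poly_Mapping.lookup (cell_boundary X B) a \<noteq> 0"

definition coreduction_pair :: "'a cell_complex \<Rightarrow> 'a \<Rightarrow> 'a \<Rightarrow> bool" where
  "coreduction_pair X A b \<longleftrightarrow>
     A \<in> cells X \<and> b \<in> cells X \<and> cell_boundary X A = cell_chain b"

definition restrict_chain :: "'a set \<Rightarrow> 'a chain \<Rightarrow> 'a chain" where
  "restrict_chain S c =
     (\<Sum>a \<in> Poly_Mapping.keys c \<inter> S. Poly_Mapping.single a (Poly_Mapping.lookup c a))"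

definition remove_cells :: "'a cell_complex \<Rightarrow> 'a set \<Rightarrow> 'a cell_complex" where
  "remove_cells X S =
     X\<lparr>cells := cells X - S, bd := (\<lambda>p c. restrict_chain (cells X - S) (bd X p c))\<rparr>"

section \<open>Homology of a filtered complex\<close>

definition filtering_function :: "'a cell_complex \<Rightarrow> ('a \<Rightarrow> int) \<Rightarrow> bool" where
  "filtering_function X g \<longleftrightarrow> (\<forall>a B. is_face X a B \<longrightarrow> g a \<le> g B)"

definition sublevel :: "'a cell_complex \<Rightarrow> ('a \<Rightarrow> int) \<Rightarrow> int \<Rightarrow> 'a cell_complex" where
  "sublevel X g t = X\<lparr>cells := {c \<in> cells X. g c \<le> t}\<rparr>"

definition cycles :: "'a cell_complex \<Rightarrow> nat \<Rightarrow> 'a chain set" where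
  "cycles X p = {c \<in> carrier (chain_group X p). bd X p c = 0}"

definition boundaries :: "'a cell_complex \<Rightarrow> nat \<Rightarrow> 'a chain set" where
  "boundaries X p = bd X (Suc p) ` carrier (chain_group X (Suc p))"

definition homology :: "'a cell_complex \<Rightarrow> nat \<Rightarrow> 'a chain set monoid" where
  "homology X p = (chain_group X p)\<lparr>carrier := cycles X p\<rparr> Mod boundaries X p"

text \<open>For a subcomplex \<open>X\<close> of \<open>Y\<close> the class \<open>z + B\<close> of a cycle \<open>z\<close> in \<open>X\<close> (with \<open>B\<close> the boundaries
  of \<open>X\<close>) is contained in its class \<open>z + B'\<close> in \<open>Y\<close>, and adding the subgroup \<open>B'\<close> to the coset
  \<open>z + B\<close> elementwise yields \<open>z + B'\<close>.\<close>

definition homology_inclusion ::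
  "'a cell_complex \<Rightarrow> nat \<Rightarrow> 'a chain set \<Rightarrow> 'a chain set" where
  "homology_inclusion Y p z = z <#>\<^bsub>chain_group Y p\<^esub> boundaries Y p"

section \<open>Persistence modules and their interval decompositions\<close>

text \<open>\<open>trans_map M i j\<close> is only meaningful for \<open>i \<le> j\<close> and on the carrier of \<open>space_at M i\<close>.\<close>

record 'v persistence_module =
  space_at :: "int \<Rightarrow> 'v monoid"
  trans_map :: "int \<Rightarrow> int \<Rightarrow> 'v \<Rightarrow> 'v"

definition persistence_iso :: "'v persistence_module \<Rightarrow> 'w persistence_module \<Rightarrow> bool" where
  "persistence_iso M N \<longleftrightarrow>
     (\<exists>\<phi>. (\<forall>i. \<phi> i \<in> iso (space_at M i) (space_at N i)) \<and>
          (\<forall>i j. i \<le> j \<longrightarrow> (\<forall>x \<in> carrier (space_at M i).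
             \<phi> j (trans_map M i j x) = trans_map N i j (\<phi> i x))))"

definition persistent_homology ::
  "'a cell_complex \<Rightarrow> ('a \<Rightarrow> int) \<Rightarrow> nat \<Rightarrow> 'a chain set persistence_module" where
  "persistent_homology X g p =
     \<lparr>space_at = (\<lambda>i. homology (sublevel X g i) p),
      trans_map = (\<lambda>i j. homology_inclusion (sublevel X g j) p)\<rparr>"

text \<open>The interval \<open>(s, e)\<close> is half-open: its class is alive exactly at the indices \<open>i\<close> with
  \<open>s \<le> i < e\<close>. Births are integers because the complex is finite, so that all homology vanishes
  at small indices; classes that never die have death \<open>\<infinity>\<close>.\<close>

type_synonym persistence_interval = "int \<times> int extended"

definition alive :: "persistence_interval \<Rightarrow> int \<Rightarrow> bool" where
  "alive I i \<longleftrightarrow> fst I \<le> i \<and> Fin i < snd I"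

definition interval_module :: "persistence_interval \<Rightarrow> bit persistence_module" where
  "interval_module I =
     \<lparr>space_at = (\<lambda>i. \<lparr>carrier = (if alive I i then UNIV else {0}), monoid.mult = (+), one = 0\<rparr>),
      trans_map = (\<lambda>i j x. if alive I i \<and> alive I j then x else 0)\<rparr>"

definition direct_sum ::
  "'k set \<Rightarrow> ('k \<Rightarrow> 'v persistence_module) \<Rightarrow> ('k \<Rightarrow> 'v) persistence_module" where
  "direct_sum K M =
     \<lparr>space_at = (\<lambda>i. sum_group K (\<lambda>k. space_at (M k) i)),
      trans_map = (\<lambda>i j x. \<lambda>k\<in>K. trans_map (M k) i j (x k))\<rparr>"

definition interval_decomposition ::
  "'v persistence_module \<Rightarrow> persistence_interval multiset \<Rightarrow> bool" where
  "interval_decomposition M P \<longleftrightarrow>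
     (\<forall>I \<in># P. Fin (fst I) < snd I) \<and>
     (\<exists>Is. mset Is = P \<and>
        persistence_iso M (direct_sum {..<length Is} (\<lambda>k. interval_module (Is ! k))))"

text \<open>By the structure theorem for persistence modules (existence of the decomposition, and its
  uniqueness up to order), for a finite filtered complex there is exactly one multiset \<open>P\<close> with
  \<open>interval_decomposition (persistent_homology X g p) P\<close>, namely the multiset of persistence
  intervals in dimension \<open>p\<close>. The condition below therefore says that the multisets of the two
  filtered complexes coincide, without the need to pick them by a description operator.\<close>

definition same_persistent_homology ::
  "'a cell_complex \<Rightarrow> ('a \<Rightarrow> int) \<Rightarrow> 'b cell_complex \<Rightarrow> ('b \<Rightarrow> int) \<Rightarrow> nat \<Rightarrow> bool" where
  "same_persistent_homology X g Y h p \<longleftrightarrow>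
     (\<forall>P. interval_decomposition (persistent_homology X g p) P \<longleftrightarrow>
          interval_decomposition (persistent_homology Y h p) P)"

end

theory Submission
  imports Defs
begin

text \<open>Since \<open>\<partial>A = b\<close> and \<open>\<partial>b = \<partial>\<partial>A = 0\<close>, the cells \<open>A\<close> and \<open>b\<close> span a subcomplex, and deleting them
  amounts to passing to the quotient complex: the restriction of chains to the remaining cells is a
  surjective chain map with kernel \<open>\<langle>A, b\<rangle>\<close>. As \<open>g A = g b\<close>, the kernel meets every sublevel
  complex either in \<open>0\<close> or in the acyclic complex \<open>\<langle>A, b\<rangle>\<close>, so the restriction induces isomorphisms
  on the homology of all sublevel complexes. They commute with the maps induced by inclusion, hence
  the persistence modules are isomorphic and have the same interval decompositions.\<close>

section \<open>Isomorphic persistence modules\<close>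

lemma persistence_iso_trans:
  assumes "persistence_iso L M" "persistence_iso M N"
  shows "persistence_iso L N"
proof -
  obtain \<phi> where \<phi>: "\<And>i. \<phi> i \<in> iso (space_at L i) (space_at M i)"
    and \<phi>t: "\<And>i j x. i \<le> j \<Longrightarrow> x \<in> carrier (space_at L i) \<Longrightarrow>
      \<phi> j (trans_map L i j x) = trans_map M i j (\<phi> i x)"
    using assms(1) unfolding persistence_iso_def by blast
  obtain \<psi> where \<psi>: "\<And>i. \<psi> i \<in> iso (space_at M i) (space_at N i)"
    and \<psi>t: "\<And>i j x. i \<le> j \<Longrightarrow> x \<in> carrier (space_at M i) \<Longrightarrow>
      \<psi> j (trans_map M i j x) = trans_map N i j (\<psi> i x)"
    using assms(2) unfolding persistence_iso_def by blast
  have "\<phi> i x \<in> carrier (space_at M i)" if "x \<in> carrier (space_at L i)" for i x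
    using \<phi>[of i] that by (auto simp: iso_def hom_def)
  then show ?thesis
    unfolding persistence_iso_def
    by (intro exI[of _ "\<lambda>i. \<psi> i \<circ> \<phi> i"]) (auto simp: \<phi>t \<psi>t intro: iso_set_trans[OF \<phi> \<psi>])
qed

text \<open>Each level is inverted separately. The hypothesis \<open>closed\<close> keeps
  \<open>trans_map M i j\<close> inside the carrier, the only place where \<open>inv_into\<close> is
  known to cancel \<open>\<phi> j\<close>.\<close>

lemma persistence_iso_sym:
  assumes iso: "persistence_iso M N"
    and group: "\<And>i. group (space_at M i)"
    and closed: "\<And>i j x. i \<le> j \<Longrightarrow> x \<in> carrier (space_at M i) \<Longrightarrow>
      trans_map M i j x \<in> carrier (space_at M j)"
  shows "persistence_iso N M"
proof -
  obtain \<phi> where \<phi>: "\<And>i. \<phi> i \<in> iso (space_at M i) (space_at N i)"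
    and \<phi>t: "\<And>i j x. i \<le> j \<Longrightarrow> x \<in> carrier (space_at M i) \<Longrightarrow>
      \<phi> j (trans_map M i j x) = trans_map N i j (\<phi> i x)"
    using iso unfolding persistence_iso_def by blast
  let ?\<psi> = "\<lambda>i. inv_into (carrier (space_at M i)) (\<phi> i)"
  have bij: "bij_betw (\<phi> i) (carrier (space_at M i)) (carrier (space_at N i))" for i
    using \<phi>[of i] by (simp add: iso_def)
  have "?\<psi> j (trans_map N i j x) = trans_map M i j (?\<psi> i x)"
    if "i \<le> j" and x: "x \<in> carrier (space_at N i)" for i j x
  proof -
    have y: "?\<psi> i x \<in> carrier (space_at M i)" "\<phi> i (?\<psi> i x) = x"
      using bij[of i] x by (auto simp: bij_betw_def inv_into_into f_inv_into_f)
    show ?thesis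
      using \<phi>t[OF that(1) y(1)] closed[OF that(1) y(1)] bij[of j] y(2)
      by (metis bij_betw_inv_into_left)
  qed
  then show ?thesis
    unfolding persistence_iso_def
    by (intro exI[of _ ?\<psi>]) (auto intro: group.iso_set_sym[OF group \<phi>])
qed

text \<open>A decomposition refers to a module only through \<open>persistence_iso\<close> into a
  direct sum of interval modules, so composing with an isomorphism in either direction carries
  decompositions over.\<close>

lemma same_persistent_homologyI:
  assumes "persistence_iso (persistent_homology X g p) (persistent_homology Y h p)"
    and "persistence_iso (persistent_homology Y h p) (persistent_homology X g p)"
  shows "same_persistent_homology X g Y h p"
proof -
  have "persistence_iso (persistent_homology X g p) N \<longleftrightarrow> persistence_iso (persistent_homology Y h p) N"
    for N :: "(nat \<Rightarrow> bit) persistence_module"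
    using persistence_iso_trans[OF assms(1)] persistence_iso_trans[OF assms(2)] by blast
  then show ?thesis
    by (simp add: same_persistent_homology_def interval_decomposition_def)
qed

text \<open>Correspondence theorem for quotients: two cosets with the same image differ by a kernel
  element, which \<open>N\<close> absorbs. Cosets are sets, so the induced map is literally the
  image map. It is later applied with cycles for \<open>G\<close> and boundaries for
  \<open>N\<close>.\<close>

lemma (in group_hom) image_iso_FactGroup:
  assumes surj: "h ` carrier G = carrier H" and N: "N \<lhd> G" and ker: "kernel G H h \<subseteq> N"
  shows "(`) h \<in> iso (G Mod N) (H Mod (h ` N))"
proof -
  interpret N: normal N G by fact
  have coset: "h ` (N #> x) = h ` N #>\<^bsub>H\<^esub> h x" if "x \<in> carrier G" for x
    using that by (force simp: r_coset_def N.mem_carrier)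
  have mult: "h ` (S <#> T) = h ` S <#>\<^bsub>H\<^esub> h ` T" if "S \<subseteq> carrier G" "T \<subseteq> carrier G" for S T
    using that by (force simp: set_mult_def subset_iff)
  have sub: "S \<subseteq> carrier G" if "S \<in> rcosets N" for S
    using that N.rcosets_carrier by blast
  have image: "(`) h ` (rcosets N) = rcosets\<^bsub>H\<^esub> (h ` N)"
    unfolding RCOSETS_def surj[symmetric] by (auto simp: coset image_iff)
  have inj: "inj_on ((`) h) (rcosets N)"
  proof (rule inj_onI)
    fix S T assume "S \<in> rcosets N" "T \<in> rcosets N" and eq: "h ` S = h ` T"
    then obtain x y where x: "x \<in> carrier G" "S = N #> x" and y: "y \<in> carrier G" "T = N #> y"
      by (auto simp: RCOSETS_def)
    have "h x \<in> h ` T"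
      using x G.rcos_self[OF x(1) N.subgroup_axioms] eq by blast
    then obtain z where z: "z \<in> T" "h x = h z" by blast
    then have zG: "z \<in> carrier G" using y G.r_coset_subset_G N.subset by blast
    \<comment> \<open>Here \<open>z\<close> is a member of \<open>T\<close> with the same image as
      \<open>x\<close>; the quotient lies in \<open>N\<close>, hence \<open>x\<close> lies in the
      coset of \<open>z\<close>, which is \<open>T\<close>.\<close>
    have "x \<otimes> inv z \<in> kernel G H h"
      using x zG z by (simp add: kernel_def)
    then have "x \<otimes> inv z \<in> N" using ker by blast
    then have "x \<in> N #> z"
      using x(1) zG by (force simp: r_coset_def G.m_assoc)
    moreover have "N #> z = T"
      using z y N.subgroup_axioms by (metis G.repr_independence)
    ultimately show "S = T"
      using x y N.subgroup_axioms by (metis G.repr_independence)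
  qed
  show ?thesis
    unfolding iso_def hom_def bij_betw_def
    using image inj by (auto simp: FactGroup_def mult sub)
qed

section \<open>Chains of sublevel complexes\<close>

lemma chain_group_simps [simp]:
  "c \<in> carrier (chain_group X p) \<longleftrightarrow> Poly_Mapping.keys c \<subseteq> {a \<in> cells X. cell_dim X a = p}"
  "monoid.mult (chain_group X p) = (+)"
  "one (chain_group X p) = 0"
  by (simp_all add: chain_group_def)

lemma comm_group_chain_group: "comm_group (chain_group X p)"
proof (rule comm_groupI)
  fix c d assume "c \<in> carrier (chain_group X p)" "d \<in> carrier (chain_group X p)"
  then show "c \<otimes>\<^bsub>chain_group X p\<^esub> d \<in> carrier (chain_group X p)"
    using keys_add[of c d] by auto
next
  fix c assume "c \<in> carrier (chain_group X p)"
  then show "\<exists>d\<in>carrier (chain_group X p). d \<otimes>\<^bsub>chain_group X p\<^esub> c = \<one>\<^bsub>chain_group X p\<^esub>"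
    by (intro bexI[of _ "-c"]) auto
qed (auto simp: add_ac)

lemma inv_chain_group:
  "c \<in> carrier (chain_group X p) \<Longrightarrow> inv\<^bsub>chain_group X p\<^esub> c = - c"
  by (rule group.inv_equality[OF comm_group.axioms(2)[OF comm_group_chain_group]])
     auto

section \<open>Restriction of chains to a set of cells\<close>

lemma lookup_restrict_chain:
  "Poly_Mapping.lookup (restrict_chain S c) a = (if a \<in> S then Poly_Mapping.lookup c a else 0)"
proof -
  have "Poly_Mapping.lookup (restrict_chain S c) a =
    (\<Sum>x \<in> Poly_Mapping.keys c \<inter> S. if x = a then Poly_Mapping.lookup c x else 0)"
    unfolding restrict_chain_def lookup_sum by (intro sum.cong) (auto simp: lookup_single when_def)
  also have "\<dots> = (if a \<in> S then Poly_Mapping.lookup c a else 0)"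
    by (auto simp: sum.delta in_keys_iff)
  finally show ?thesis .
qed

lemma restrict_chain_add: "restrict_chain S (c + d) = restrict_chain S c + restrict_chain S d"
  by (rule poly_mapping_eqI) (simp add: lookup_restrict_chain lookup_add)

lemma restrict_chain_0: "restrict_chain S 0 = 0"
  by (simp add: restrict_chain_def)

lemma keys_restrict_chain: "Poly_Mapping.keys (restrict_chain S c) = Poly_Mapping.keys c \<inter> S"
  by (auto simp: in_keys_iff lookup_restrict_chain split: if_splits)

lemma restrict_chain_id: "Poly_Mapping.keys c \<subseteq> S \<Longrightarrow> restrict_chain S c = c"
  by (rule poly_mapping_eqI) (auto simp: lookup_restrict_chain in_keys_iff)

text \<open>The only nonzero scalar of \<open>bit\<close> is 1, so the support determines the
  chain.\<close>

lemma chain_eq_cell_chain: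
  fixes c :: "'a chain"
  assumes "Poly_Mapping.keys c \<subseteq> {a}" "c \<noteq> 0"
  shows "c = cell_chain a"
proof (rule poly_mapping_eqI)
  fix x
  have keys: "Poly_Mapping.keys c = {a}"
    using assms by (metis keys_eq_empty subset_singletonD)
  show "Poly_Mapping.lookup c x = Poly_Mapping.lookup (cell_chain a) x"
  proof (cases "x = a")
    case True
    then have "Poly_Mapping.lookup c x \<noteq> 0"
      using keys by (metis in_keys_iff insertI1)
    then show ?thesis using True by simp
  next
    case False
    then have "x \<notin> Poly_Mapping.keys c" using keys by simp
    then have "Poly_Mapping.lookup c x = 0" by (metis in_keys_iff)
    then show ?thesis using False by (simp add: lookup_single)
  qed
qed

section \<open>Boundary operators of a chain complex\<close>

context
  fixes X :: "'a cell_complex"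
  assumes complex: "chain_complex X"
begin

lemma bd_closed:
  "c \<in> carrier (chain_group X (Suc p)) \<Longrightarrow> bd X (Suc p) c \<in> carrier (chain_group X p)"
  using complex unfolding chain_complex_def by (blast intro: hom_in_carrier)

lemma bd_add:
  assumes "c \<in> carrier (chain_group X p)" "d \<in> carrier (chain_group X p)"
  shows "bd X p (c + d) = bd X p c + bd X p d"
\<comment> \<open>\<open>chain_complex\<close> provides a homomorphism in positive dimensions only;
  in dimension 0 the boundary vanishes on all chains.\<close>
proof (cases p)
  case 0
  have "c + d \<in> carrier (chain_group X p)" using assms keys_add[of c d] by auto
  then show ?thesis using complex assms 0 unfolding chain_complex_def by simp
next
  case (Suc q)
  then have "bd X p \<in> hom (chain_group X p) (chain_group X q)"
    using complex unfolding chain_complex_def by blast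
  from hom_mult[OF this assms] show ?thesis by simp
qed

lemma bd_0: "bd X p 0 = 0"
  using bd_add[of 0 p 0] by simp

lemma bd_bd: "c \<in> carrier (chain_group X (Suc p)) \<Longrightarrow> bd X p (bd X (Suc p) c) = 0"
  using complex unfolding chain_complex_def by blast

lemma bd_uminus:
  assumes "c \<in> carrier (chain_group X p)"
  shows "bd X p (- c) = - bd X p c"
  using bd_add[of c p "- c"] assms bd_0[of p] by (simp add: eq_neg_iff_add_eq_0 add.commute)

text \<open>The boundary of \<open>c\<close> is the sum of the boundaries of its cells. Terms may
  cancel over \<open>bit\<close>, so only one inclusion holds. It reduces statements about
  boundaries of chains to the face relation.\<close>

lemma keys_bd_subset:
  assumes "c \<in> carrier (chain_group X p)" "x \<in> Poly_Mapping.keys (bd X p c)"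
  shows "\<exists>a \<in> Poly_Mapping.keys c. x \<in> Poly_Mapping.keys (cell_boundary X a)"
  using assms
proof (induction "card (Poly_Mapping.keys c)" arbitrary: c)
  case 0
  then show ?case by (simp add: bd_0)
next
  case (Suc n)
  then obtain a where a: "a \<in> Poly_Mapping.keys c" by fastforce
  \<comment> \<open>The induction peels off one cell \<open>a\<close> of the support;
    \<open>?d\<close> is what is left of \<open>c\<close>.\<close>
  let ?d = "restrict_chain (- {a}) c"
  have c: "c = cell_chain a + ?d"
  proof (rule poly_mapping_eqI)
    have "Poly_Mapping.lookup c a = 1" using a by (simp add: in_keys_iff)
    then show "Poly_Mapping.lookup c x = Poly_Mapping.lookup (cell_chain a + ?d) x" for x
      by (auto simp: lookup_add lookup_single lookup_restrict_chain when_def)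
  qed
  have d: "?d \<in> carrier (chain_group X p)" "cell_chain a \<in> carrier (chain_group X p)"
    using Suc.prems(1) a by (auto simp: keys_restrict_chain)
  have "bd X p c = cell_boundary X a + bd X p ?d"
    using bd_add[OF d(2,1)] c d(2) by (simp add: cell_boundary_def)
  then have "x \<in> Poly_Mapping.keys (cell_boundary X a) \<or> x \<in> Poly_Mapping.keys (bd X p ?d)"
    using Suc.prems(2) keys_add[of "cell_boundary X a" "bd X p ?d"] by auto
  moreover have "n = card (Poly_Mapping.keys ?d)"
    using Suc.hyps(2) a by (simp add: keys_restrict_chain Diff_eq[symmetric])
  ultimately show ?case
    using Suc.hyps(1)[OF _ d(1)] a by (auto simp: keys_restrict_chain)
qed

section \<open>Cycles and boundaries as subgroups\<close>

lemma subgroup_cycles: "subgroup (cycles X p) (chain_group X p)"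
proof (rule group.subgroupI[OF comm_group.axioms(2)[OF comm_group_chain_group]])
  fix c d assume cd: "c \<in> cycles X p" "d \<in> cycles X p"
  then show "c \<otimes>\<^bsub>chain_group X p\<^esub> d \<in> cycles X p"
    using keys_add[of c d] bd_add[of c p d] by (auto simp: cycles_def)
  show "inv\<^bsub>chain_group X p\<^esub> c \<in> cycles X p"
    using cd bd_uminus[of c p] inv_chain_group[of c X p] by (auto simp: cycles_def)
qed (use bd_0 in \<open>auto simp: cycles_def intro!: exI[of _ 0]\<close>)

lemma comm_group_cycles: "comm_group ((chain_group X p)\<lparr>carrier := cycles X p\<rparr>)"
  by (rule group.group_comm_groupI[OF subgroup.subgroup_is_group[OF subgroup_cycles
        comm_group.axioms(2)[OF comm_group_chain_group]]]) (simp add: add.commute)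

lemma normal_boundaries: "boundaries X p \<lhd> (chain_group X p)\<lparr>carrier := cycles X p\<rparr>"
proof (rule comm_group.subgroup_imp_normal[OF comm_group_cycles])
  have "bd X (Suc p) \<in> hom (chain_group X (Suc p)) (chain_group X p)"
    using complex unfolding chain_complex_def by blast
  then interpret group_hom "chain_group X (Suc p)" "chain_group X p" "bd X (Suc p)"
    by (intro group_hom.intro group_hom_axioms.intro comm_group.axioms(2) comm_group_chain_group)
  have "subgroup (boundaries X p) (chain_group X p)"
    unfolding boundaries_def using img_is_subgroup by simp
  then show "subgroup (boundaries X p) ((chain_group X p)\<lparr>carrier := cycles X p\<rparr>)"
    by (rule group.subgroup_incl[OF comm_group.axioms(2)[OF comm_group_chain_group] _ subgroup_cycles])
       (use bd_bd bd_closed in \<open>auto simp: boundaries_def cycles_def simp del: chain_group_simps\<close>)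
qed

text \<open>A cell in the boundary of a sublevel chain is a face of some cell of that chain, so
  \<open>g\<close> is at most \<open>t\<close> there too. The remaining conditions are inherited
  because \<open>bd\<close> is unchanged.\<close>

lemma chain_complex_sublevel:
  assumes "filtering_function X g"
  shows "chain_complex (sublevel X g t)"
proof -
  have sub: "c \<in> carrier (chain_group X p)" if "c \<in> carrier (chain_group (sublevel X g t) p)" for c p
    using that by (auto simp: sublevel_def)
  have "bd X (Suc p) c \<in> carrier (chain_group (sublevel X g t) p)"
    if c: "c \<in> carrier (chain_group (sublevel X g t) (Suc p))" for c p
  proof -
    have "x \<in> cells X \<and> cell_dim X x = p \<and> g x \<le> t" if x: "x \<in> Poly_Mapping.keys (bd X (Suc p) c)" for x
    proof -
      obtain a where a: "a \<in> Poly_Mapping.keys c" "x \<in> Poly_Mapping.keys (cell_boundary X a)"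
        using keys_bd_subset[OF sub[OF c] x] by blast
      have "x \<in> cells X" "cell_dim X x = p" using bd_closed[OF sub[OF c]] x by auto
      moreover have "a \<in> cells X" "g a \<le> t" using a c by (auto simp: sublevel_def)
      ultimately have "is_face X x a" using a(2) by (simp add: is_face_def in_keys_iff)
      then show ?thesis
        using assms \<open>g a \<le> t\<close> \<open>x \<in> cells X\<close> \<open>cell_dim X x = p\<close>
        unfolding filtering_function_def by force
    qed
    then show ?thesis by (auto simp: sublevel_def)
  qed
  moreover have "bd (sublevel X g t) = bd X" "finite (cells (sublevel X g t))"
    using complex by (simp_all add: sublevel_def chain_complex_def)
  ultimately show ?thesis
    unfolding chain_complex_def hom_def
    using complex[unfolded chain_complex_def] bd_add[OF sub sub] bd_bd[OF sub] sub
    by (simp del: chain_group_simps(1) add: Pi_iff)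
qed

lemma group_homology: "group (homology X p)"
  unfolding homology_def by (rule normal.factorgroup_is_group[OF normal_boundaries])

end

text \<open>Boundaries of \<open>X\<close> are absorbed by those of \<open>Y\<close>, so the class
  of \<open>z\<close> in \<open>X\<close> becomes exactly the class of \<open>z\<close> in
  \<open>Y\<close>. This serves the closure condition of \<open>persistence_iso_sym\<close>.\<close>

lemma homology_inclusion_closed:
  assumes X: "chain_complex X" and Y: "chain_complex Y"
    and cycles: "cycles X p \<subseteq> cycles Y p" and boundaries: "boundaries X p \<subseteq> boundaries Y p"
    and S: "S \<in> carrier (homology X p)"
  shows "homology_inclusion Y p S \<in> carrier (homology Y p)"
proof -
  interpret B: normal "boundaries Y p" "(chain_group Y p)\<lparr>carrier := cycles Y p\<rparr>"
    by (rule normal_boundaries[OF Y])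
  obtain z where z: "z \<in> cycles X p" "S = {h + z | h. h \<in> boundaries X p}"
    using S by (auto simp: homology_def FactGroup_def RCOSETS_def r_coset_def)
  have zero: "0 \<in> boundaries X p"
    using normal.axioms(1)[OF normal_boundaries[OF X]] subgroup.one_closed by fastforce
  have "homology_inclusion Y p S = {h + z | h. h \<in> boundaries Y p}" (is "?L = ?R")
  proof
    show "?L \<subseteq> ?R"
    proof
      fix x assume "x \<in> ?L"
      then obtain h k where hk: "h \<in> boundaries X p" "k \<in> boundaries Y p" "x = (h + z) + k"
        unfolding homology_inclusion_def set_mult_def z(2) by auto
      then have "h + k \<in> boundaries Y p" using boundaries subgroup.m_closed[OF B.subgroup_axioms, of h k] by auto
      moreover have "x = (h + k) + z" using hk(3) by (simp add: add_ac)
      ultimately show "x \<in> ?R" by blast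
    qed
    show "?R \<subseteq> ?L"
    proof
      fix x assume "x \<in> ?R"
      then obtain k where k: "k \<in> boundaries Y p" "x = z + k" by (auto simp: add.commute)
      have "z \<in> S" unfolding z(2) using zero by force
      then show "x \<in> ?L" unfolding homology_inclusion_def set_mult_def using k by auto
    qed
  qed
  then show ?thesis
    using z(1) cycles by (auto simp: homology_def FactGroup_def RCOSETS_def r_coset_def)
qed

section \<open>Removing a coreduction pair\<close>

locale filtered_coreduction =
  fixes K :: "'a cell_complex" and g :: "'a \<Rightarrow> int" and A b :: 'a
  assumes complex: "chain_complex K"
    and filtering: "filtering_function K g"
    and pair: "coreduction_pair K A b"
    and level: "g A = g b"
begin

abbreviation sub :: "int \<Rightarrow> 'a cell_complex" where
  "sub t \<equiv> sublevel K g t"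

abbreviation reduced :: "int \<Rightarrow> 'a cell_complex" where
  "reduced t \<equiv> sublevel (remove_cells K {A, b}) g t"

text \<open>This is the quotient map by the span of \<open>A\<close> and \<open>b\<close>, with the
  quotient represented on the remaining cells. Including those cells back into \<open>K\<close> need
  not commute with the boundary operators.\<close>

abbreviation retract :: "'a chain \<Rightarrow> 'a chain" where
  "retract \<equiv> restrict_chain (cells K - {A, b})"

lemma sub_simps [simp]:
  "cells (sub t) = {c \<in> cells K. g c \<le> t}" "cell_dim (sub t) = cell_dim K" "bd (sub t) = bd K"
  by (simp_all add: sublevel_def)

lemma reduced_simps [simp]:
  "cells (reduced t) = {c \<in> cells K - {A, b}. g c \<le> t}" "cell_dim (reduced t) = cell_dim K"
  "bd (reduced t) p c = retract (bd K p c)"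
  by (simp_all add: sublevel_def remove_cells_def)

lemma complex_sub: "chain_complex (sub t)"
  by (rule chain_complex_sublevel[OF complex filtering])

section \<open>Dimensions and boundaries of the pair\<close>

lemma pair_cells: "A \<in> cells K" "b \<in> cells K"
  using pair by (auto simp: coreduction_pair_def)

lemma bd_A: "bd K (cell_dim K A) (cell_chain A) = cell_chain b"
  using pair by (auto simp: coreduction_pair_def cell_boundary_def)

lemma cell_chain_nonzero: "cell_chain b \<noteq> 0"
  by (metis lookup_single_eq lookup_zero zero_neq_one)

text \<open>The boundary of \<open>A\<close> is the nonzero chain \<open>cell_chain b\<close>. This
  rules out dimension 0, and otherwise the degree of the boundary operator fixes the dimension of
  \<open>b\<close>.\<close>

lemma dim_A: "cell_dim K A = Suc (cell_dim K b)"
proof (cases "cell_dim K A")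
  case 0
  then have "bd K 0 (cell_chain A) = 0"
    using complex pair_cells by (simp add: chain_complex_def)
  then show ?thesis using bd_A 0 cell_chain_nonzero by simp
next
  case (Suc q)
  then have "cell_chain b \<in> carrier (chain_group K q)"
    using bd_closed[OF complex, of "cell_chain A" q] bd_A pair_cells by simp
  then show ?thesis using Suc by simp
qed

lemma bd_b: "bd K (cell_dim K b) (cell_chain b) = 0"
  using bd_bd[OF complex, of "cell_chain A" "cell_dim K b"] bd_A dim_A pair_cells by simp

lemma retract_pair: "retract (cell_chain A) = 0" "retract (cell_chain b) = 0"
  by (rule poly_mapping_eqI; simp add: lookup_restrict_chain lookup_single when_def)+

text \<open>The complex spanned by \<open>A\<close> and \<open>b\<close> is acyclic in every sublevel complex.\<close>

lemma kernel_retract_exact: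
  assumes u: "u \<in> carrier (chain_group (sub t) p)" and "retract u = 0" and "bd K p u = 0"
  shows "\<exists>e \<in> carrier (chain_group (sub t) (Suc p)). bd K (Suc p) e = u \<and> retract e = 0"
proof (cases "u = 0")
  case True
  then show ?thesis
    using bd_0[OF complex] by (intro bexI[of _ 0]) (auto simp: restrict_chain_0)
next
  case False
  have keys: "Poly_Mapping.keys u \<subseteq> {A, b}"
    using keys_restrict_chain[of "cells K - {A, b}" u] u assms(2) by auto
  \<comment> \<open>If \<open>A\<close> occurred, the degree would exclude \<open>b\<close>, so
    \<open>u\<close> would be \<open>cell_chain A\<close>, whose boundary
    \<open>cell_chain b\<close> is nonzero.\<close>
  have "A \<notin> Poly_Mapping.keys u"
  proof
    assume "A \<in> Poly_Mapping.keys u"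
    then have "p = cell_dim K A" using u by auto
    then have "Poly_Mapping.keys u \<subseteq> {A}" using keys u dim_A by force
    then show False
      using chain_eq_cell_chain False bd_A cell_chain_nonzero assms(3) \<open>p = cell_dim K A\<close> by metis
  qed
  then have "Poly_Mapping.keys u \<subseteq> {b}" using keys by auto
  then have ub: "u = cell_chain b" by (rule chain_eq_cell_chain[OF _ False])
  \<comment> \<open>Here \<open>g A = g b\<close> enters: since \<open>b\<close> has already
    appeared by level \<open>t\<close>, so has \<open>A\<close>, and it can fill \<open>b\<close> in
    the same sublevel.\<close>
  have p: "p = cell_dim K b" and "g A \<le> t" using u level by (simp_all add: ub)
  then have "cell_chain A \<in> carrier (chain_group (sub t) (Suc p))"
    using pair_cells by (simp add: dim_A)
  moreover have "bd K (Suc p) (cell_chain A) = u"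
    using bd_A by (simp add: p ub dim_A)
  ultimately show ?thesis using retract_pair(1) by blast
qed

text \<open>This makes \<open>retract\<close> a chain map. The part of \<open>c\<close> discarded by
  it is 0, \<open>A\<close> or \<open>b\<close>, because \<open>A\<close> and \<open>b\<close> have
  different dimensions; its boundary is 0 or \<open>b\<close>, which \<open>retract\<close>
  kills.\<close>

lemma retract_bd:
  assumes c: "c \<in> carrier (chain_group K p)"
  shows "retract (bd K p (retract c)) = retract (bd K p c)"
proof -
  let ?d = "restrict_chain {A, b} c"
  have split: "c = retract c + ?d"
  proof (rule poly_mapping_eqI)
    fix x
    have "x \<in> cells K \<or> Poly_Mapping.lookup c x = 0"
      using c in_keys_iff[of x c] by auto
    then show "Poly_Mapping.lookup c x = Poly_Mapping.lookup (retract c + ?d) x"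
      by (auto simp: lookup_add lookup_restrict_chain)
  qed
  have carr: "retract c \<in> carrier (chain_group K p)" "?d \<in> carrier (chain_group K p)"
    using c by (auto simp: keys_restrict_chain)
  have "?d = 0 \<or> ?d = cell_chain A \<and> p = cell_dim K A \<or> ?d = cell_chain b \<and> p = cell_dim K b"
  proof (cases "?d = 0")
    case False
    have "Poly_Mapping.keys ?d \<subseteq> {A} \<or> Poly_Mapping.keys ?d \<subseteq> {b}"
      using carr(2) dim_A by (auto simp: keys_restrict_chain)
    then have "?d = cell_chain A \<or> ?d = cell_chain b"
      using chain_eq_cell_chain[OF _ False] by blast
    then show ?thesis using carr(2) by auto
  qed simp
  then have "retract (bd K p ?d) = 0"
    using bd_A bd_b bd_0[OF complex] retract_pair restrict_chain_0 by auto
  then show ?thesis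
    using bd_add[OF complex carr] split by (metis add.right_neutral restrict_chain_add)
qed

section \<open>Images of chains, boundaries and cycles under the quotient map\<close>

lemma sub_chain: "c \<in> carrier (chain_group (sub t) p) \<Longrightarrow> c \<in> carrier (chain_group K p)"
  by auto

lemma retract_chain:
  "c \<in> carrier (chain_group (sub t) p) \<Longrightarrow> retract c \<in> carrier (chain_group (reduced t) p)"
  by (auto simp: keys_restrict_chain)

lemma reduced_chain:
  assumes "c \<in> carrier (chain_group (reduced t) p)"
  shows "c \<in> carrier (chain_group (sub t) p)" "retract c = c"
  using assms by (auto intro!: restrict_chain_id)

lemma retract_boundaries: "retract ` boundaries (sub t) p = boundaries (reduced t) p"
proof
  show "retract ` boundaries (sub t) p \<subseteq> boundaries (reduced t) p"
  proof
    fix x assume "x \<in> retract ` boundaries (sub t) p"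
    then obtain c where c: "c \<in> carrier (chain_group (sub t) (Suc p))" "x = retract (bd K (Suc p) c)"
      by (auto simp: boundaries_def simp del: chain_group_simps)
    then have "x = bd (reduced t) (Suc p) (retract c)"
      using retract_bd[OF sub_chain[OF c(1)]] by simp
    then show "x \<in> boundaries (reduced t) p"
      unfolding boundaries_def using retract_chain[OF c(1)] by blast
  qed
  \<comment> \<open>A reduced chain is itself a chain of \<open>sub t\<close>, and its reduced
    boundary is by definition the retract of its boundary in \<open>K\<close>.\<close>
  show "boundaries (reduced t) p \<subseteq> retract ` boundaries (sub t) p"
    using reduced_chain(1) by (auto simp: boundaries_def simp del: chain_group_simps)
qed

text \<open>Surjectivity is a diagram chase: a reduced cycle \<open>y\<close> has a boundary in
  \<open>K\<close> that \<open>retract\<close> kills. By acyclicity of the kernel it is also the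
  boundary of some \<open>e\<close> in the kernel, and \<open>y - e\<close> is a cycle lifting
  \<open>y\<close>.\<close>

lemma retract_cycles: "retract ` cycles (sub t) p = cycles (reduced t) p"
proof
  show "retract ` cycles (sub t) p \<subseteq> cycles (reduced t) p"
  proof
    fix x assume "x \<in> retract ` cycles (sub t) p"
    then obtain c where c: "c \<in> carrier (chain_group (sub t) p)" "x = retract c" "bd K p c = 0"
      by (auto simp: cycles_def simp del: chain_group_simps)
    moreover have "bd (reduced t) p x = 0"
      using retract_bd[OF sub_chain[OF c(1)]] c by (simp add: restrict_chain_0)
    ultimately show "x \<in> cycles (reduced t) p"
      unfolding cycles_def using retract_chain[OF c(1)] by blast
  qed
  show "cycles (reduced t) p \<subseteq> retract ` cycles (sub t) p"
  proof
    fix y assume "y \<in> cycles (reduced t) p"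
    then have yr: "y \<in> carrier (chain_group (reduced t) p)" and ret: "retract (bd K p y) = 0"
      unfolding cycles_def by auto
    note y = reduced_chain[OF yr]
    show "y \<in> retract ` cycles (sub t) p"
    \<comment> \<open>In dimension 0 the chain \<open>y\<close> is already a cycle; the chase needs
      a degree \<open>q\<close> below \<open>p\<close> in which the boundary of \<open>y\<close>
      lives.\<close>
    proof (cases p)
      case 0
      then have "bd K p y = 0" using complex sub_chain[OF y(1)] unfolding chain_complex_def by blast
      then have "y \<in> cycles (sub t) p" using y(1) by (simp add: cycles_def)
      then show ?thesis using y(2) by force
    next
      case (Suc q)
      have u: "bd K p y \<in> carrier (chain_group (sub t) q)"
        using bd_closed[OF complex_sub] y(1) Suc by simp
      have "bd K q (bd K p y) = 0"
        using bd_bd[OF complex] sub_chain[OF y(1)] Suc by simp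
      then obtain e where e: "e \<in> carrier (chain_group (sub t) p)" "bd K p e = bd K p y" "retract e = 0"
        using kernel_retract_exact[OF u ret] Suc by blast
      let ?z = "y + - e"
      have me: "- e \<in> carrier (chain_group (sub t) p)" using e(1) by simp
      have "bd K p ?z = 0"
        using bd_add[OF complex sub_chain[OF y(1)] sub_chain[OF me]]
          bd_uminus[OF complex sub_chain[OF e(1)]] e(2) by simp
      moreover have "?z \<in> carrier (chain_group (sub t) p)"
        using y(1) me keys_add[of y "- e"] by auto
      ultimately have "?z \<in> cycles (sub t) p" by (simp add: cycles_def)
      \<comment> \<open>Additivity is applied to the sum of \<open>?z\<close> and \<open>e\<close>,
        which is \<open>y\<close>; \<open>retract\<close> fixes \<open>y\<close> and kills
        \<open>e\<close>.\<close>
      moreover have "retract ?z = y"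
        using y(2) e(3) restrict_chain_add[of "cells K - {A, b}" ?z e] by simp
      ultimately show ?thesis by force
    qed
  qed
qed

text \<open>A cycle killed by \<open>retract\<close> is a boundary by acyclicity of the kernel, so
  \<open>image_iso_FactGroup\<close> applies to \<open>retract\<close> on cycles.\<close>

lemma retract_homology_iso: "(`) retract \<in> iso (homology (sub t) p) (homology (reduced t) p)"
proof -
  let ?G = "(chain_group (sub t) p)\<lparr>carrier := cycles (sub t) p\<rparr>"
  let ?H = "(chain_group (reduced t) p)\<lparr>carrier := cycles (reduced t) p\<rparr>"
  have hom: "retract \<in> hom ?G ?H"
    using retract_cycles[of t p] by (auto simp: hom_def restrict_chain_add)
  interpret G: comm_group ?G by (rule comm_group_cycles[OF complex_sub])
  \<comment> \<open>The reduced cycles form a group as the homomorphic image of the cycles of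
    \<open>sub t\<close>.\<close>
  have H: "group ?H"
  proof -
    have "group (?H\<lparr>carrier := retract ` carrier ?G, one := retract \<one>\<^bsub>?G\<^esub>\<rparr>)"
      by (rule G.hom_imp_img_group[OF hom])
    then show ?thesis by (simp add: retract_cycles restrict_chain_0 chain_group_def)
  qed
  interpret group_hom ?G ?H retract
    by (intro group_hom.intro group_hom_axioms.intro G.group_axioms H hom)
  have "kernel ?G ?H retract \<subseteq> boundaries (sub t) p"
  proof
    fix z assume "z \<in> kernel ?G ?H retract"
    then have "z \<in> carrier (chain_group (sub t) p)" "retract z = 0" "bd K p z = 0"
      by (auto simp: kernel_def cycles_def)
    from kernel_retract_exact[OF this] show "z \<in> boundaries (sub t) p"
      unfolding boundaries_def by (auto simp del: chain_group_simps)
  qed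
  from image_iso_FactGroup[OF _ normal_boundaries[OF complex_sub] this] show ?thesis
    by (simp add: homology_def retract_boundaries retract_cycles)
qed

text \<open>Naturality: \<open>retract\<close> is additive and maps boundaries onto boundaries, so
  it carries the sum of \<open>S\<close> and the boundaries to the sum of their images.\<close>

lemma retract_homology_inclusion:
  "retract ` homology_inclusion (sub t) p S = homology_inclusion (reduced t) p (retract ` S)"
  by (force simp: homology_inclusion_def set_mult_def restrict_chain_add retract_boundaries[symmetric])

lemma persistence_iso_reduced:
  "persistence_iso (persistent_homology K g p) (persistent_homology (remove_cells K {A, b}) g p)"
  unfolding persistence_iso_def persistent_homology_def
  \<comment> \<open>\<open>retract\<close> does not depend on the level, so one image map serves at
    every index.\<close>
  by (intro exI[of _ "\<lambda>_. (`) retract"])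
     (simp add: retract_homology_iso retract_homology_inclusion)

lemma homology_inclusion_sub_closed:
  assumes "i \<le> j" "S \<in> carrier (homology (sub i) p)"
  shows "homology_inclusion (sub j) p S \<in> carrier (homology (sub j) p)"
proof (rule homology_inclusion_closed[OF complex_sub complex_sub _ _ assms(2)])
  have "carrier (chain_group (sub i) q) \<subseteq> carrier (chain_group (sub j) q)" for q
    using assms(1) by fastforce
  then show "cycles (sub i) p \<subseteq> cycles (sub j) p" "boundaries (sub i) p \<subseteq> boundaries (sub j) p"
    unfolding cycles_def boundaries_def sub_simps by blast+
qed

end

theorem theorem4p2:
  fixes K :: "'a cell_complex" and g :: "'a \<Rightarrow> int" and A b :: 'a
  assumes "chain_complex K"
    and "filtering_function K g"
    and "coreduction_pair K A b"
    and "g A = g b"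
  shows "\<forall>p. same_persistent_homology K g (remove_cells K {A, b}) g p"
proof
  fix p
  interpret filtered_coreduction K g A b by unfold_locales (use assms in auto)
  show "same_persistent_homology K g (remove_cells K {A, b}) g p"
  \<comment> \<open>The isomorphism starts at the module of \<open>K\<close>, so inverting it asks
    for groups and closure on that side.\<close>
  proof (rule same_persistent_homologyI[OF persistence_iso_reduced persistence_iso_sym[OF persistence_iso_reduced]])
    show "group (space_at (persistent_homology K g p) i)" for i
      by (simp add: persistent_homology_def group_homology[OF complex_sub])
  next
    fix i j x assume "i \<le> j" "x \<in> carrier (space_at (persistent_homology K g p) i)"
    then show "trans_map (persistent_homology K g p) i j x
        \<in> carrier (space_at (persistent_homology K g p) j)"
      by (simp add: persistent_homology_def homology_inclusion_sub_closed)
  qed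
qed

end
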